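(* Let $d\in\mathbb{N}$ and let $w$ be a $\mathbb{C}^{d\times d}$-valued function on the unit circle $\mathbb{T}$ such that $w\in L_1^{d\times d}(\mathbb{T})$, $w(e^{i\theta})$ is a positive Hermitian matrix for $\sigma$-a.e. $\theta$, and $w^{-1}\in L_1^{d\times d}(\mathbb{T})$. Let $\{X_k:k\in\mathbb{Z}\}$ be a $\mathbb{C}^d$-valued, centered, weakly stationary process with spectral density $w$, and let $\{X_k':k\in\mathbb{Z}\}$ be its dual process. Then, for $n\in\mathbb{N}$ and $s,t\in\{1,\dots,n\}$, $$\left(T_n(w)^{-1}\right)^{s,t}=\langle X'_s,P_{[1,n]}X'_t\rangle .$$
   Context: $\mathbb{T}=\{z\in\mathbb{C}:|z|=1\}$, $\sigma=d\theta/(2\pi)$ on $[-\pi,\pi)$; $L_1^{d\times d}(\mathbb{T})$ is the space of $\mathbb{C}^{d\times d}$-valued functions with entries in $L_1(\mathbb{T},\sigma)$. $A^*$ is the conjugate transpose. $\gamma(k)=\int_{-\pi}^{\pi}e^{-ik\theta}w(e^{i\theta})\frac{d\theta}{2\pi}$ for $k\in\mathbb{Z}$, and $T_n(w)\in\mathbb{C}^{dn\times dn}$ is the block matrix whose $(s,t)$ block is $\gamma(s-t)$, $1\le s,t\le n$. For $A\in\mathbb{C}^{dn\times dn}$, $A^{s,t}\in\mathbb{C}^{d\times d}$ denotes its $(s,t)$ block. $\{X_k\}$ is defined on a probability space $(\Omega,\mathcal{F},P)$, and having spectral density $w$ means $E[X_kX_l^*]=\gamma(k-l)$ for $k,l\in\mathbb{Z}$.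 Write $X_k=(X_k^1,\dots,X_k^d)^\top$. $V$ is the closed complex linear span of $\{X_k^j:k\in\mathbb{Z},\,j=1,\dots,d\}$ in $L^2(\Omega,\mathcal{F},P)$, a Hilbert space with inner product $(x,y)_V=E[x\overline{y}]$. $V_{[1,n]}^X$ is the (closed) linear span of $\{X_k^j: j=1,\dots,d,\ 1\le k\le n\}$ and $P_{[1,n]}$ is the orthogonal projection of $V$ onto $V_{[1,n]}^X$. $V^d$ is the space of $\mathbb{C}^d$-valued random variables with entries in $V$; $P_{[1,n]}$ acts on $V^d$ entrywise. For $x,y\in V^d$, $\langle x,y\rangle=E[xy^*]\in\mathbb{C}^{d\times d}$ is the Gram matrix. Under the assumptions on $w$, $\{X_k\}$ has a dual process $\{X'_k\}$: the $\mathbb{C}^d$-valued, centered, weakly stationary process with $X'_k\in V^d$ characterized by the biorthogonality relation $\langle X_s,X'_t\rangle=\delta_{st}I_d$ for $s,t\in\mathbb{Z}$. *)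

theory Defs
  imports
    "HOL-Probability.Probability"
    "HOL-Library.Function_Algebras"
    "Jordan_Normal_Form.Gauss_Jordan_Elimination"
    "Jordan_Normal_Form.Schur_Decomposition"
begin

text \<open>
  Vectors and matrices are those of \<^theory>\<open>Jordan_Normal_Form.Matrix\<close>, since the size
  \<open>d * n\<close> varies with \<open>n\<close>. Components inside a vector or a block are indexed from 0;
  times and block positions keep their usual indexing.
\<close>

unbundle no vec_syntax
unbundle no inner_syntax

section \<open>Matrix functions on the unit circle\<close>

text \<open>Functions on the circle are integrated through the parametrisation \<^term>\<open>cis\<close>.\<close>

definition circle_measure :: "real measure" where
  "circle_measure = density (restrict_space lebesgue {-pi..<pi}) (\<lambda>_. ennreal (1 / (2 * pi)))"

definition L1_mat :: "nat \<Rightarrow> (complex \<Rightarrow> complex mat) \<Rightarrow> bool" where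
  "L1_mat d f \<longleftrightarrow> (\<forall>i<d. \<forall>j<d. integrable circle_measure (\<lambda>\<theta>. f (cis \<theta>) $$ (i, j)))"

text \<open>
  In the order on \<^typ>\<open>complex\<close>, \<open>0 < z\<close> says that \<open>z\<close> is real and positive; so positive means
  positive definite here.
\<close>

definition positive_hermitian :: "nat \<Rightarrow> complex mat \<Rightarrow> bool" where
  "positive_hermitian d A \<longleftrightarrow> A \<in> carrier_mat d d \<and> mat_adjoint A = A \<and>
     (\<forall>v\<in>carrier_vec d. v \<noteq> 0\<^sub>v d \<longrightarrow> 0 < (A *\<^sub>v v) \<bullet>c v)"

text \<open>Unspecified where \<open>A\<close> is singular.\<close>

abbreviation minv :: "complex mat \<Rightarrow> complex mat" where
  "minv A \<equiv> the (mat_inverse A)"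

definition fourier_coeff :: "nat \<Rightarrow> (complex \<Rightarrow> complex mat) \<Rightarrow> int \<Rightarrow> complex mat" where
  "fourier_coeff d w k = mat d d (\<lambda>(i, j).
     (LINT \<theta>|circle_measure. exp (- \<i> * of_int k * of_real \<theta>) * w (cis \<theta>) $$ (i, j)))"

definition block_toeplitz :: "nat \<Rightarrow> nat \<Rightarrow> (complex \<Rightarrow> complex mat) \<Rightarrow> complex mat" where
  "block_toeplitz d n w = mat (d * n) (d * n) (\<lambda>(a, b).
     fourier_coeff d w (int (a div d) - int (b div d)) $$ (a mod d, b mod d))"

text \<open>The block in position \<open>(s, t)\<close>, for \<open>1 \<le> s\<close> and \<open>1 \<le> t\<close>.\<close>

definition mat_block :: "nat \<Rightarrow> complex mat \<Rightarrow> nat \<Rightarrow> nat \<Rightarrow> complex mat" where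
  "mat_block d A s t = mat d d (\<lambda>(i, j). A $$ ((s - 1) * d + i, (t - 1) * d + j))"


section \<open>Square-integrable random variables\<close>

text \<open>
  Elements of \<open>L\<^sup>2\<close> are represented by functions, not by classes modulo almost sure equality.
\<close>

definition L2_space :: "'a measure \<Rightarrow> ('a \<Rightarrow> complex) set" where
  "L2_space M = {x \<in> borel_measurable M. integrable M (\<lambda>\<omega>. (cmod (x \<omega>))\<^sup>2)}"

definition L2_inner :: "'a measure \<Rightarrow> ('a \<Rightarrow> complex) \<Rightarrow> ('a \<Rightarrow> complex) \<Rightarrow> complex" where
  "L2_inner M x y = (LINT \<omega>|M. x \<omega> * cnj (y \<omega>))"

definition L2_dist :: "'a measure \<Rightarrow> ('a \<Rightarrow> complex) \<Rightarrow> ('a \<Rightarrow> complex) \<Rightarrow> real" where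
  "L2_dist M x y = sqrt (LINT \<omega>|M. (cmod (x \<omega> - y \<omega>))\<^sup>2)"

definition L2_closure :: "'a measure \<Rightarrow> ('a \<Rightarrow> complex) set \<Rightarrow> ('a \<Rightarrow> complex) set" where
  "L2_closure M S = {y \<in> L2_space M. \<forall>\<epsilon>>0. \<exists>x\<in>S. L2_dist M y x < \<epsilon>}"

text \<open>A representative of the orthogonal projection; it is unique up to almost sure equality.\<close>

definition orth_proj :: "'a measure \<Rightarrow> ('a \<Rightarrow> complex) set \<Rightarrow> ('a \<Rightarrow> complex) \<Rightarrow> 'a \<Rightarrow> complex" where
  "orth_proj M S x = (SOME y. y \<in> S \<and> (\<forall>z\<in>S. L2_inner M (\<lambda>\<omega>. x \<omega> - y \<omega>) z = 0))"

definition orth_proj_vec ::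
  "nat \<Rightarrow> 'a measure \<Rightarrow> ('a \<Rightarrow> complex) set \<Rightarrow> ('a \<Rightarrow> complex vec) \<Rightarrow> 'a \<Rightarrow> complex vec" where
  "orth_proj_vec d M S x = (\<lambda>\<omega>. vec d (\<lambda>j. orth_proj M S (\<lambda>\<omega>'. x \<omega>' $ j) \<omega>))"

definition gram :: "nat \<Rightarrow> 'a measure \<Rightarrow> ('a \<Rightarrow> complex vec) \<Rightarrow> ('a \<Rightarrow> complex vec) \<Rightarrow> complex mat" where
  "gram d M x y = mat d d (\<lambda>(i, j). L2_inner M (\<lambda>\<omega>. x \<omega> $ i) (\<lambda>\<omega>. y \<omega> $ j))"


section \<open>Stationary processes\<close>

definition centered_weakly_stationary ::
  "nat \<Rightarrow> 'a measure \<Rightarrow> (int \<Rightarrow> 'a \<Rightarrow> complex vec) \<Rightarrow> bool" where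
  "centered_weakly_stationary d M X \<longleftrightarrow>
     (\<forall>k. \<forall>\<omega>\<in>space M. X k \<omega> \<in> carrier_vec d) \<and>
     (\<forall>k. \<forall>j<d. (\<lambda>\<omega>. X k \<omega> $ j) \<in> L2_space M) \<and>
     (\<forall>k. \<forall>j<d. (LINT \<omega>|M. X k \<omega> $ j) = 0) \<and>
     (\<forall>k l m. gram d M (X (k + m)) (X (l + m)) = gram d M (X k) (X l))"

definition has_spectral_density ::
  "nat \<Rightarrow> 'a measure \<Rightarrow> (int \<Rightarrow> 'a \<Rightarrow> complex vec) \<Rightarrow> (complex \<Rightarrow> complex mat) \<Rightarrow> bool" where
  "has_spectral_density d M X w \<longleftrightarrow>
     (\<forall>k l. gram d M (X k) (X l) = fourier_coeff d w (k - l))"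

text \<open>
  The closed complex linear span of the entries of \<open>X k\<close>, \<open>k \<in> K\<close>. The space \<open>V\<close> is the case
  \<open>K = UNIV\<close>, and \<open>V[1,n]\<close> is the case \<open>K = {1..int n}\<close>.
\<close>

definition process_space ::
  "nat \<Rightarrow> 'a measure \<Rightarrow> (int \<Rightarrow> 'a \<Rightarrow> complex vec) \<Rightarrow> int set \<Rightarrow> ('a \<Rightarrow> complex) set" where
  "process_space d M X K =
     L2_closure M (Modules.module.span (\<lambda>c x \<omega>. c * x \<omega>) {(\<lambda>\<omega>. X k \<omega> $ j) | k j. k \<in> K \<and> j < d})"

definition dual_process ::
  "nat \<Rightarrow> 'a measure \<Rightarrow> (int \<Rightarrow> 'a \<Rightarrow> complex vec) \<Rightarrow> (int \<Rightarrow> 'a \<Rightarrow> complex vec) \<Rightarrow> bool" where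
  "dual_process d M X X' \<longleftrightarrow>
     centered_weakly_stationary d M X' \<and>
     (\<forall>k. \<forall>j<d. (\<lambda>\<omega>. X' k \<omega> $ j) \<in> process_space d M X UNIV) \<and>
     (\<forall>s t. gram d M (X s) (X' t) = (if s = t then 1\<^sub>m d else 0\<^sub>m d d))"

end

theory Submission
  imports Defs
begin

text \<open>
  Flatten the entries of \<open>X 1, \<dots>, X n\<close> and \<open>X' 1, \<dots>, X' n\<close> into two families \<open>x\<close> and \<open>y\<close> of
  \<open>d * n\<close> scalar random variables. By the definition of the spectral density, the block Toeplitz
  matrix is the Gram matrix \<open>G\<close> of \<open>x\<close>, and duality says that \<open>x\<close> and \<open>y\<close> are
  biorthogonal. The theorem is thus an instance of a fact about finite biorthogonal families in
  \<open>L\<^sup>2\<close>, \<open>biorthogonal_gram_inverse\<close>.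

  Biorthogonality makes \<open>G\<close> nonsingular: a kernel vector \<open>v\<close> of \<open>G\<close> gives a combination of \<open>x\<close>
  of norm zero, and pairing this combination with \<open>y b\<close> returns the coefficient of \<open>x b\<close>. Let \<open>B\<close>
  be the inverse. The projection of \<open>y b\<close> on the span of \<open>x\<close> is
  \<open>p b = (\<Sum>c. B(b, c) x c)\<close>, because \<open>B * G = 1\<close> says that \<open>p b\<close> and \<open>y b\<close> have the same
  inner product with each \<open>x a\<close>. Finally, projections are self-adjoint, so
  \<open>\<langle>y a, p b\<rangle> = \<langle>p a, y b\<rangle>\<close>, and biorthogonality evaluates the right side to \<open>B(a, b)\<close>.

  Random variables are functions here, and the projection is a chosen representative. Inner
  products with it can be computed from \<open>p b\<close> because any two candidates agree almost everywhere
  (\<open>orth_proj_AE_eq\<close>); \<open>p b\<close> is a candidate because orthogonality to \<open>x\<close> passes to the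
  closure of the span (\<open>L2_inner_closure_eq_0\<close>).
\<close>

section \<open>Square-integrable functions\<close>

lemma L2_space_integrable_inner:
  assumes "x \<in> L2_space M" "y \<in> L2_space M"
  shows "integrable M (\<lambda>\<omega>. x \<omega> * cnj (y \<omega>))"
proof (rule Bochner_Integration.integrable_bound)
  show "integrable M (\<lambda>\<omega>. (cmod (x \<omega>))\<^sup>2 + (cmod (y \<omega>))\<^sup>2)"
    using assms by (auto simp: L2_space_def)
  have [measurable]: "x \<in> borel_measurable M" "y \<in> borel_measurable M"
    using assms by (auto simp: L2_space_def)
  have [measurable]: "(\<lambda>\<omega>. cnj (y \<omega>)) \<in> borel_measurable M"
    by (rule measurable_compose[of y M borel cnj borel])
       (auto intro!: borel_measurable_continuous_onI continuous_intros)
  show "(\<lambda>\<omega>. x \<omega> * cnj (y \<omega>)) \<in> borel_measurable M"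
    by measurable
  show "AE \<omega> in M. cmod (x \<omega> * cnj (y \<omega>)) \<le> norm ((cmod (x \<omega>))\<^sup>2 + (cmod (y \<omega>))\<^sup>2)"
  proof (rule AE_I2)
    fix \<omega>
    have "2 * (cmod (x \<omega>) * cmod (y \<omega>)) \<le> (cmod (x \<omega>))\<^sup>2 + (cmod (y \<omega>))\<^sup>2"
      using sum_squares_bound[of "cmod (x \<omega>)" "cmod (y \<omega>)"] by (simp add: mult.assoc)
    moreover have "0 \<le> cmod (x \<omega>) * cmod (y \<omega>)"
      by simp
    ultimately have "cmod (x \<omega> * cnj (y \<omega>)) \<le> (cmod (x \<omega>))\<^sup>2 + (cmod (y \<omega>))\<^sup>2"
      unfolding norm_mult complex_mod_cnj by linarith
    then show "cmod (x \<omega> * cnj (y \<omega>)) \<le> norm ((cmod (x \<omega>))\<^sup>2 + (cmod (y \<omega>))\<^sup>2)"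
      by simp
  qed
qed

lemma L2_space_zero: "(\<lambda>\<omega>. 0) \<in> L2_space M"
  by (simp add: L2_space_def)

lemma L2_space_cmult:
  assumes "x \<in> L2_space M"
  shows "(\<lambda>\<omega>. c * x \<omega>) \<in> L2_space M"
  using assms by (auto simp: L2_space_def norm_mult power_mult_distrib)

lemma L2_space_add:
  assumes x: "x \<in> L2_space M" and y: "y \<in> L2_space M"
  shows "(\<lambda>\<omega>. x \<omega> + y \<omega>) \<in> L2_space M"
proof -
  have [measurable]: "x \<in> borel_measurable M" "y \<in> borel_measurable M"
    using assms by (auto simp: L2_space_def)
  have "integrable M (\<lambda>\<omega>. (cmod (x \<omega> + y \<omega>))\<^sup>2)"
  proof (rule Bochner_Integration.integrable_bound)
    show "integrable M (\<lambda>\<omega>. 2 * (cmod (x \<omega>))\<^sup>2 + 2 * (cmod (y \<omega>))\<^sup>2)"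
      using assms by (auto simp: L2_space_def)
    show "AE \<omega> in M. norm ((cmod (x \<omega> + y \<omega>))\<^sup>2) \<le> norm (2 * (cmod (x \<omega>))\<^sup>2 + 2 * (cmod (y \<omega>))\<^sup>2)"
    proof (rule AE_I2)
      fix \<omega>
      have "(cmod (x \<omega> + y \<omega>))\<^sup>2 \<le> (cmod (x \<omega>) + cmod (y \<omega>))\<^sup>2"
        by (intro power_mono norm_triangle_ineq) simp
      also have "\<dots> \<le> 2 * (cmod (x \<omega>))\<^sup>2 + 2 * (cmod (y \<omega>))\<^sup>2"
        using sum_squares_bound[of "cmod (x \<omega>)" "cmod (y \<omega>)"] by (simp add: power2_sum)
      finally show "norm ((cmod (x \<omega> + y \<omega>))\<^sup>2) \<le> norm (2 * (cmod (x \<omega>))\<^sup>2 + 2 * (cmod (y \<omega>))\<^sup>2)"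
        by simp
    qed
  qed measurable
  then show ?thesis
    by (simp add: L2_space_def)
qed

lemma L2_space_diff:
  assumes "x \<in> L2_space M" "y \<in> L2_space M"
  shows "(\<lambda>\<omega>. x \<omega> - y \<omega>) \<in> L2_space M"
  using L2_space_add[OF assms(1) L2_space_cmult[OF assms(2), of "- 1"]] by simp

lemma L2_space_lincomb:
  assumes "\<And>i. i \<in> I \<Longrightarrow> x i \<in> L2_space M"
  shows "(\<lambda>\<omega>. \<Sum>i\<in>I. c i * x i \<omega>) \<in> L2_space M"
  using assms
  by (induction I rule: infinite_finite_induct) (auto simp: L2_space_zero L2_space_add L2_space_cmult)

section \<open>The inner product of square-integrable functions\<close>

lemma L2_inner_cnj: "L2_inner M y x = cnj (L2_inner M x y)"
proof -
  have "cnj (L2_inner M x y) = (LINT \<omega>|M. cnj (x \<omega> * cnj (y \<omega>)))"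
    by (simp add: L2_inner_def flip: Bochner_Integration.integral_cnj)
  then show ?thesis
    by (simp add: L2_inner_def mult.commute)
qed

lemma L2_inner_zero_left [simp]: "L2_inner M (\<lambda>\<omega>. 0) z = 0"
  by (simp add: L2_inner_def)

lemma L2_inner_cmult_left: "L2_inner M (\<lambda>\<omega>. c * x \<omega>) z = c * L2_inner M x z"
  by (simp add: L2_inner_def mult.assoc)

lemma L2_inner_add_left:
  assumes "x \<in> L2_space M" "y \<in> L2_space M" "z \<in> L2_space M"
  shows "L2_inner M (\<lambda>\<omega>. x \<omega> + y \<omega>) z = L2_inner M x z + L2_inner M y z"
  using assms by (simp add: L2_inner_def distrib_right L2_space_integrable_inner)

lemma L2_inner_diff_left:
  assumes "x \<in> L2_space M" "y \<in> L2_space M" "z \<in> L2_space M"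
  shows "L2_inner M (\<lambda>\<omega>. x \<omega> - y \<omega>) z = L2_inner M x z - L2_inner M y z"
  using assms by (simp add: L2_inner_def left_diff_distrib L2_space_integrable_inner)

lemma L2_inner_lincomb_left:
  assumes "\<And>i. i \<in> I \<Longrightarrow> x i \<in> L2_space M" "z \<in> L2_space M"
  shows "L2_inner M (\<lambda>\<omega>. \<Sum>i\<in>I. c i * x i \<omega>) z = (\<Sum>i\<in>I. c i * L2_inner M (x i) z)"
  using assms
  by (induction I rule: infinite_finite_induct)
     (simp_all add: L2_inner_add_left L2_space_cmult L2_space_lincomb L2_inner_cmult_left)

lemma L2_inner_lincomb_right:
  assumes "\<And>i. i \<in> I \<Longrightarrow> x i \<in> L2_space M" "z \<in> L2_space M"
  shows "L2_inner M z (\<lambda>\<omega>. \<Sum>i\<in>I. c i * x i \<omega>) = (\<Sum>i\<in>I. cnj (c i) * L2_inner M z (x i))"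
  unfolding L2_inner_cnj[of M z] using assms by (simp add: L2_inner_lincomb_left)

lemma L2_inner_self: "L2_inner M x x = of_real (LINT \<omega>|M. (cmod (x \<omega>))\<^sup>2)"
  unfolding L2_inner_def
  by (simp only: complex_norm_square[symmetric] flip: of_real_power)
     (simp only: integral_complex_of_real)

lemma L2_inner_self_eq_0_iff:
  assumes "x \<in> L2_space M"
  shows "L2_inner M x x = 0 \<longleftrightarrow> (AE \<omega> in M. x \<omega> = 0)"
proof -
  have "integrable M (\<lambda>\<omega>. (cmod (x \<omega>))\<^sup>2)"
    using assms by (simp add: L2_space_def)
  from integral_nonneg_eq_0_iff_AE[OF this] show ?thesis
    by (simp add: L2_inner_self)
qed

lemma L2_inner_cong_AE_right:
  assumes "y \<in> L2_space M" "y' \<in> L2_space M" "x \<in> L2_space M"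
    and "AE \<omega> in M. y \<omega> = y' \<omega>"
  shows "L2_inner M x y = L2_inner M x y'"
  unfolding L2_inner_def
proof (rule integral_cong_AE)
  show "(\<lambda>\<omega>. x \<omega> * cnj (y \<omega>)) \<in> borel_measurable M" "(\<lambda>\<omega>. x \<omega> * cnj (y' \<omega>)) \<in> borel_measurable M"
    using assms by (simp_all add: L2_space_integrable_inner borel_measurable_integrable)
  show "AE \<omega> in M. x \<omega> * cnj (y \<omega>) = x \<omega> * cnj (y' \<omega>)"
    using assms(4) by eventually_elim simp
qed

text \<open>
  The weighted inequality of arithmetic and geometric means, integrated. The free weight \<open>c\<close> lets
  it replace the Cauchy-Schwarz inequality in continuity arguments.
\<close>

lemma L2_inner_weighted_bound:
  assumes x: "x \<in> L2_space M" and y: "y \<in> L2_space M" and c: "c > 0"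
  shows "2 * cmod (L2_inner M x y)
    \<le> c * (LINT \<omega>|M. (cmod (x \<omega>))\<^sup>2) + (LINT \<omega>|M. (cmod (y \<omega>))\<^sup>2) / c"
proof -
  have int: "integrable M (\<lambda>\<omega>. (cmod (x \<omega>))\<^sup>2)" "integrable M (\<lambda>\<omega>. (cmod (y \<omega>))\<^sup>2)"
    using x y by (auto simp: L2_space_def)
  have "2 * cmod (L2_inner M x y) \<le> 2 * (LINT \<omega>|M. cmod (x \<omega> * cnj (y \<omega>)))"
    unfolding L2_inner_def by (intro mult_left_mono integral_norm_bound) simp
  also have "\<dots> = (LINT \<omega>|M. 2 * cmod (x \<omega> * cnj (y \<omega>)))"
    by simp
  also have "\<dots> \<le> (LINT \<omega>|M. c * (cmod (x \<omega>))\<^sup>2 + (cmod (y \<omega>))\<^sup>2 / c)"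
  proof (rule integral_mono)
    show "integrable M (\<lambda>\<omega>. 2 * cmod (x \<omega> * cnj (y \<omega>)))"
      using L2_space_integrable_inner[OF x y] by (intro integrable_mult_right integrable_norm)
    show "integrable M (\<lambda>\<omega>. c * (cmod (x \<omega>))\<^sup>2 + (cmod (y \<omega>))\<^sup>2 / c)"
      using int by simp
    fix \<omega>
    have "0 \<le> (c * cmod (x \<omega>) - cmod (y \<omega>))\<^sup>2 / c"
      using c by simp
    also have "\<dots> = c * (cmod (x \<omega>))\<^sup>2 + (cmod (y \<omega>))\<^sup>2 / c - 2 * (cmod (x \<omega>) * cmod (y \<omega>))"
      using c by (simp add: power2_eq_square field_simps)
    finally show "2 * cmod (x \<omega> * cnj (y \<omega>)) \<le> c * (cmod (x \<omega>))\<^sup>2 + (cmod (y \<omega>))\<^sup>2 / c"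
      by (simp add: norm_mult)
  qed
  also have "\<dots> = c * (LINT \<omega>|M. (cmod (x \<omega>))\<^sup>2) + (LINT \<omega>|M. (cmod (y \<omega>))\<^sup>2) / c"
    using int by simp
  finally show ?thesis .
qed

section \<open>Closed spans and orthogonal projections\<close>

lemma L2_closure_superset:
  assumes "S \<subseteq> L2_space M"
  shows "S \<subseteq> L2_closure M S"
proof
  fix x
  assume x: "x \<in> S"
  have "L2_dist M x x = 0"
    by (simp add: L2_dist_def)
  with x have "\<exists>x'\<in>S. L2_dist M x x' < \<epsilon>" if "\<epsilon> > 0" for \<epsilon>
    using that by (intro bexI[of _ x]) auto
  with x assms show "x \<in> L2_closure M S"
    by (auto simp: L2_closure_def)
qed

text \<open>
  Approximating \<open>z\<close> by \<open>z' \<in> S\<close> within \<open>e\<close> gives \<open>\<langle>u, z\<rangle> = \<langle>u, z - z'\<rangle>\<close>. With the weight \<open>c = e\<close>, both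
  terms of \<open>L2_inner_weighted_bound\<close> are of order \<open>e\<close>.
\<close>

lemma L2_inner_closure_eq_0:
  assumes u: "u \<in> L2_space M" and S: "S \<subseteq> L2_space M"
    and orth: "\<And>z. z \<in> S \<Longrightarrow> L2_inner M u z = 0"
    and z: "z \<in> L2_closure M S"
  shows "L2_inner M u z = 0"
proof -
  define U where "U = (LINT \<omega>|M. (cmod (u \<omega>))\<^sup>2)"
  have U: "U \<ge> 0"
    by (simp add: U_def)
  have zL: "z \<in> L2_space M"
    using z by (simp add: L2_closure_def)
  have bound: "2 * cmod (L2_inner M u z) \<le> e * (U + 1)" if e: "e > 0" for e
  proof -
    obtain z' where z': "z' \<in> S" "L2_dist M z z' < e"
      using z e by (auto simp: L2_closure_def)
    have z'L: "z' \<in> L2_space M"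
      using z' S by auto
    define D where "D = (LINT \<omega>|M. (cmod (z \<omega> - z' \<omega>))\<^sup>2)"
    have D: "D \<ge> 0"
      by (simp add: D_def)
    have "sqrt D < e"
      using z' by (simp add: L2_dist_def D_def)
    then have De: "D \<le> e\<^sup>2"
      using D by (metis less_eq_real_def real_sqrt_le_iff real_sqrt_abs abs_of_pos e)
    have "L2_inner M (\<lambda>\<omega>. z \<omega> - z' \<omega>) u = L2_inner M z u"
      using L2_inner_diff_left[OF zL z'L u] orth[OF z'(1)] L2_inner_cnj[of M z' u] by simp
    then have "L2_inner M u z = L2_inner M u (\<lambda>\<omega>. z \<omega> - z' \<omega>)"
      by (simp add: L2_inner_cnj[of M u])
    then have "2 * cmod (L2_inner M u z) \<le> e * U + D / e"
      using L2_inner_weighted_bound[OF u L2_space_diff[OF zL z'L] e] by (simp add: U_def D_def)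
    also have "D / e \<le> e"
      using De e by (simp add: divide_le_eq power2_eq_square)
    finally show ?thesis
      by (simp add: algebra_simps)
  qed
  have "2 * cmod (L2_inner M u z) \<le> 0"
  proof (rule field_le_epsilon)
    fix e :: real
    assume "e > 0"
    then show "2 * cmod (L2_inner M u z) \<le> 0 + e"
      using bound[of "e / (U + 1)"] U by simp
  qed
  then show ?thesis
    by simp
qed

text \<open>
  Two candidates for the projection differ by a function orthogonal to both of them, hence to
  itself. This determines inner products with the chosen representative.
\<close>

lemma orth_proj_AE_eq:
  assumes S: "S \<subseteq> L2_space M" and x: "x \<in> L2_space M"
    and p: "p \<in> S" "\<And>z. z \<in> S \<Longrightarrow> L2_inner M (\<lambda>\<omega>. x \<omega> - p \<omega>) z = 0"
  shows "orth_proj M S x \<in> S" "AE \<omega> in M. orth_proj M S x \<omega> = p \<omega>"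
proof -
  define q where "q = orth_proj M S x"
  have "q \<in> S \<and> (\<forall>z\<in>S. L2_inner M (\<lambda>\<omega>. x \<omega> - q \<omega>) z = 0)"
    unfolding q_def orth_proj_def by (rule someI[of _ p]) (use p in auto)
  then have q: "q \<in> S" "\<And>z. z \<in> S \<Longrightarrow> L2_inner M (\<lambda>\<omega>. x \<omega> - q \<omega>) z = 0"
    by auto
  show "orth_proj M S x \<in> S"
    using q by (simp add: q_def)
  have pL: "p \<in> L2_space M" and qL: "q \<in> L2_space M"
    using p q S by auto
  define r where "r = (\<lambda>\<omega>. q \<omega> - p \<omega>)"
  have rL: "r \<in> L2_space M"
    unfolding r_def by (rule L2_space_diff[OF qL pL])
  have orth: "L2_inner M r z = 0" if z: "z \<in> S" for z
  proof -
    have zL: "z \<in> L2_space M"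
      using z S by auto
    show ?thesis
      unfolding r_def L2_inner_diff_left[OF qL pL zL]
      using p(2)[OF z] q(2)[OF z] L2_inner_diff_left[OF x pL zL] L2_inner_diff_left[OF x qL zL]
      by simp
  qed
  \<comment> \<open>Only \<open>p\<close> and \<open>q\<close> are known to lie in \<open>S\<close>, not \<open>r\<close>: expand one argument first.\<close>
  have "L2_inner M r r = cnj (L2_inner M r q - L2_inner M r p)"
    using L2_inner_diff_left[OF qL pL rL] L2_inner_cnj[of M q r] L2_inner_cnj[of M p r]
    unfolding r_def[symmetric] complex_cnj_diff by argo
  also have "\<dots> = 0"
    using orth p q by simp
  finally have "AE \<omega> in M. r \<omega> = 0"
    using L2_inner_self_eq_0_iff[OF rL] by simp
  then show "AE \<omega> in M. orth_proj M S x \<omega> = p \<omega>"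
    by eventually_elim (simp add: r_def q_def)
qed

lemma module_pointwise_scale: "Modules.module (\<lambda>(c::complex) (x::'a \<Rightarrow> complex) \<omega>. c * x \<omega>)"
  by unfold_locales (auto simp: fun_eq_iff algebra_simps)

abbreviation fun_span :: "('a \<Rightarrow> complex) set \<Rightarrow> ('a \<Rightarrow> complex) set" where
  "fun_span \<equiv> Modules.module.span (\<lambda>c x \<omega>. c * x \<omega>)"

lemma fun_span_subset_L2_space:
  assumes "A \<subseteq> L2_space M"
  shows "fun_span A \<subseteq> L2_space M"
proof (rule module.span_minimal[OF module_pointwise_scale assms])
  show "Modules.module.subspace (\<lambda>c x \<omega>. c * x \<omega>) (L2_space M)"
    unfolding module.subspace_def[OF module_pointwise_scale]
    by (auto simp: L2_space_cmult plus_fun_def zero_fun_def L2_space_add L2_space_zero)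
qed

lemma fun_span_lincomb:
  assumes "finite I" "\<And>i. i \<in> I \<Longrightarrow> x i \<in> A"
  shows "(\<lambda>\<omega>. \<Sum>i\<in>I. c i * x i \<omega>) \<in> fun_span A"
proof -
  have "(\<Sum>i\<in>I. (\<lambda>\<omega>. c i * x i \<omega>)) \<in> fun_span A"
    by (intro module.span_sum[OF module_pointwise_scale] module.span_scale[OF module_pointwise_scale]
        module.span_base[OF module_pointwise_scale] assms)
  also have "(\<Sum>i\<in>I. (\<lambda>\<omega>. c i * x i \<omega>)) = (\<lambda>\<omega>. \<Sum>i\<in>I. c i * x i \<omega>)"
    using assms(1) by (induction I) (simp_all add: fun_eq_iff)
  finally show ?thesis .
qed

lemma L2_inner_fun_span_eq_0:
  assumes u: "u \<in> L2_space M" and A: "A \<subseteq> L2_space M"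
    and orth: "\<And>a. a \<in> A \<Longrightarrow> L2_inner M u a = 0"
    and z: "z \<in> fun_span A"
  shows "L2_inner M u z = 0"
proof -
  let ?K = "{z \<in> L2_space M. L2_inner M z u = 0}"
  have "fun_span A \<subseteq> ?K"
  proof (rule module.span_minimal[OF module_pointwise_scale])
    show "A \<subseteq> ?K"
      using A orth by (auto simp: L2_inner_cnj[of M _ u])
    show "Modules.module.subspace (\<lambda>c x \<omega>. c * x \<omega>) ?K"
      unfolding module.subspace_def[OF module_pointwise_scale]
      using u by (auto simp: L2_space_cmult plus_fun_def zero_fun_def L2_space_add L2_space_zero
          L2_inner_cmult_left L2_inner_add_left)
  qed
  then show ?thesis
    using z L2_inner_cnj[of M u z] by auto
qed

section \<open>Finite biorthogonal families\<close>

definition gram_matrix :: "'a measure \<Rightarrow> nat \<Rightarrow> (nat \<Rightarrow> 'a \<Rightarrow> complex) \<Rightarrow> complex mat" where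
  "gram_matrix M N x = mat N N (\<lambda>(a, b). L2_inner M (x a) (x b))"

text \<open>
  For a kernel vector \<open>v\<close> put \<open>f = (\<Sum>a. cnj (v a) x a)\<close>. The entries of \<open>G v = 0\<close> are the
  \<open>\<langle>x a, f\<rangle>\<close>, so \<open>f\<close> is orthogonal to itself and vanishes almost everywhere; but
  \<open>\<langle>y b, f\<rangle> = v b\<close>.
\<close>

lemma det_gram_matrix_nonzero:
  assumes x: "\<And>a. a < N \<Longrightarrow> x a \<in> L2_space M" and y: "\<And>a. a < N \<Longrightarrow> y a \<in> L2_space M"
    and bi: "\<And>a b. a < N \<Longrightarrow> b < N \<Longrightarrow> L2_inner M (x a) (y b) = (if a = b then 1 else 0)"
  shows "det (gram_matrix M N x) \<noteq> 0"
proof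
  let ?G = "gram_matrix M N x"
  have G: "?G \<in> carrier_mat N N"
    by (simp add: gram_matrix_def)
  assume "det ?G = 0"
  then obtain v where v: "v \<in> carrier_vec N" "v \<noteq> 0\<^sub>v N" "?G *\<^sub>v v = 0\<^sub>v N"
    using det_0_iff_vec_prod_zero[OF G] by auto
  define f where "f = (\<lambda>\<omega>. \<Sum>a\<in>{..<N}. cnj (v $ a) * x a \<omega>)"
  have fL: "f \<in> L2_space M"
    unfolding f_def by (rule L2_space_lincomb) (use x in auto)
  have inner_f: "L2_inner M z f = (\<Sum>a<N. v $ a * L2_inner M z (x a))" if "z \<in> L2_space M" for z
    unfolding f_def by (subst L2_inner_lincomb_right) (use that x in auto)
  have "L2_inner M (x a) f = 0" if a: "a < N" for a
  proof -
    have "(?G *\<^sub>v v) $ a = (\<Sum>b<N. L2_inner M (x a) (x b) * v $ b)"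
      using a v(1) by (simp add: gram_matrix_def scalar_prod_def lessThan_atLeast0)
    then show ?thesis
      using inner_f[OF x[OF a]] v(3) a by (simp add: mult.commute)
  qed
  then have "L2_inner M f f = 0"
    unfolding f_def[THEN arg_cong[where f = "\<lambda>g. L2_inner M g f"]]
    by (subst L2_inner_lincomb_left) (use x fL in auto)
  then have f0: "AE \<omega> in M. f \<omega> = 0"
    using L2_inner_self_eq_0_iff[OF fL] by simp
  have "v $ b = 0" if b: "b < N" for b
  proof -
    have "L2_inner M (y b) f = L2_inner M (y b) (\<lambda>\<omega>. 0)"
      by (rule L2_inner_cong_AE_right[OF fL L2_space_zero y[OF b] f0])
    then have "0 = L2_inner M (y b) f"
      by (simp add: L2_inner_def)
    also have "\<dots> = (\<Sum>a<N. if a = b then v $ a else 0)"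
      unfolding inner_f[OF y[OF b]]
      by (intro sum.cong refl) (use bi b L2_inner_cnj[of M "y b"] in auto)
    finally show ?thesis
      using b by simp
  qed
  then have "v = 0\<^sub>v N"
    using v(1) by (intro eq_vecI) auto
  with v(2) show False ..
qed

text \<open>
  The coefficients of the projections of the \<open>y b\<close> with respect to \<open>x\<close> are the rows of the inverse
  Gram matrix, and pairing with the biorthogonal family reads them off.
\<close>

theorem biorthogonal_gram_inverse:
  assumes x: "\<And>a. a < N \<Longrightarrow> x a \<in> L2_space M" and y: "\<And>a. a < N \<Longrightarrow> y a \<in> L2_space M"
    and bi: "\<And>a b. a < N \<Longrightarrow> b < N \<Longrightarrow> L2_inner M (x a) (y b) = (if a = b then 1 else 0)"
  shows "mat_inverse (gram_matrix M N x) =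
    Some (mat N N (\<lambda>(a, b). L2_inner M (y a)
      (orth_proj M (L2_closure M (fun_span (x ` {..<N}))) (y b))))"
proof -
  let ?G = "gram_matrix M N x" and ?L = "fun_span (x ` {..<N})"
  let ?S = "L2_closure M ?L"
  have G: "?G \<in> carrier_mat N N"
    by (simp add: gram_matrix_def)
  have xL: "x ` {..<N} \<subseteq> L2_space M"
    using x by auto
  have LL: "?L \<subseteq> L2_space M"
    by (rule fun_span_subset_L2_space[OF xL])
  have SL: "?S \<subseteq> L2_space M"
    by (auto simp: L2_closure_def)
  have "?G \<in> Units (ring_mat TYPE(complex) N ())"
    by (rule det_non_zero_imp_unit[OF G det_gram_matrix_nonzero[OF x y bi]])
  then have "mat_inverse ?G \<noteq> None"
    using mat_inverse(1)[OF G, where b = "()"] by blast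
  then obtain B where B: "mat_inverse ?G = Some B"
    by auto
  then have BG: "B * ?G = 1\<^sub>m N" and Bc: "B \<in> carrier_mat N N"
    using mat_inverse(2)[OF G B] by auto
  define p where "p b = (\<lambda>\<omega>. \<Sum>c\<in>{..<N}. B $$ (b, c) * x c \<omega>)" for b
  have pL: "p b \<in> L2_space M" for b
    unfolding p_def by (rule L2_space_lincomb) (use x in auto)
  have pS: "p b \<in> ?S" for b
  proof -
    have "p b \<in> ?L"
      unfolding p_def by (rule fun_span_lincomb) auto
    then show ?thesis
      using L2_closure_superset[OF LL] by auto
  qed
  have inner_p: "L2_inner M (p b) z = (\<Sum>c<N. B $$ (b, c) * L2_inner M (x c) z)"
    if "z \<in> L2_space M" for b z
    unfolding p_def by (rule L2_inner_lincomb_left) (use that x in auto)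
  have p_orth: "L2_inner M (\<lambda>\<omega>. y b \<omega> - p b \<omega>) z = 0" if b: "b < N" and z: "z \<in> ?S" for b z
  proof (rule L2_inner_closure_eq_0[OF L2_space_diff[OF y[OF b] pL] LL _ z])
    fix z
    assume "z \<in> ?L"
    then show "L2_inner M (\<lambda>\<omega>. y b \<omega> - p b \<omega>) z = 0"
    proof (rule L2_inner_fun_span_eq_0[OF L2_space_diff[OF y[OF b] pL] xL, rotated])
      fix u
      assume "u \<in> x ` {..<N}"
      then obtain a where a: "a < N" "u = x a"
        by auto
      have "L2_inner M (p b) (x a) = (B * ?G) $$ (b, a)"
        unfolding inner_p[OF x[OF a(1)]] using a b Bc G
        by (simp add: scalar_prod_def lessThan_atLeast0 gram_matrix_def)
      also have "\<dots> = L2_inner M (y b) (x a)"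
        using a b bi[of a b] L2_inner_cnj[of M "y b" "x a"] by (auto simp: BG)
      finally show "L2_inner M (\<lambda>\<omega>. y b \<omega> - p b \<omega>) u = 0"
        unfolding a(2) by (simp add: L2_inner_diff_left y[OF b] pL x[OF a(1)])
    qed
  qed
  have "L2_inner M (y a) (orth_proj M ?S (y b)) = B $$ (a, b)" if a: "a < N" and b: "b < N" for a b
  proof -
    note proj = orth_proj_AE_eq[OF SL y[OF b] pS p_orth[OF b]]
    have "L2_inner M (y a) (orth_proj M ?S (y b)) = L2_inner M (y a) (p b)"
      using proj SL by (intro L2_inner_cong_AE_right pL y[OF a]) auto
    \<comment> \<open>Self-adjointness of the projection: both sides equal \<open>\<langle>p a, p b\<rangle>\<close>.\<close>
    also have "\<dots> = L2_inner M (p a) (p b)"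
      using p_orth[OF a pS[of b]] by (simp add: L2_inner_diff_left y[OF a] pL)
    also have "\<dots> = L2_inner M (p a) (y b)"
      using p_orth[OF b pS[of a]]
      by (simp add: L2_inner_diff_left y[OF b] pL L2_inner_cnj[of M "p a"])
    also have "\<dots> = (\<Sum>c<N. if c = b then B $$ (a, c) else 0)"
      unfolding inner_p[OF y[OF b]] by (intro sum.cong refl) (use bi b in auto)
    also have "\<dots> = B $$ (a, b)"
      using b by simp
    finally show ?thesis .
  qed
  then have "mat N N (\<lambda>(a, b). L2_inner M (y a) (orth_proj M ?S (y b))) = B"
    using Bc by (intro eq_matI) auto
  with B show ?thesis
    by simp
qed

section \<open>The inverse of the block Toeplitz matrix\<close>

text \<open>Position \<open>a\<close> of the flattened family belongs to time \<open>a div d + 1\<close>, as times start at 1.\<close>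

definition flatten_process :: "nat \<Rightarrow> (int \<Rightarrow> 'a \<Rightarrow> complex vec) \<Rightarrow> nat \<Rightarrow> 'a \<Rightarrow> complex" where
  "flatten_process d X a = (\<lambda>\<omega>. X (int (a div d) + 1) \<omega> $ (a mod d))"

lemma flatten_process_block:
  assumes "1 \<le> s" "i < d"
  shows "flatten_process d X ((s - 1) * d + i) = (\<lambda>\<omega>. X (int s) \<omega> $ i)"
  using assms by (simp add: flatten_process_def of_nat_diff)

lemma block_index_less:
  fixes s d n i :: nat
  assumes "s \<in> {1..n}" "i < d"
  shows "(s - 1) * d + i < d * n"
proof -
  have "(s - 1) * d + i < (s - 1) * d + d"
    using assms by simp
  also have "\<dots> = s * d"
    using assms by (cases s) auto
  also have "\<dots> \<le> d * n"
    using assms by (simp add: mult.commute)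
  finally show ?thesis .
qed

lemma flatten_process_image:
  "flatten_process d X ` {..<d * n} = {(\<lambda>\<omega>. X k \<omega> $ j) | k j. k \<in> {1..int n} \<and> j < d}"
proof (intro equalityI subsetI)
  fix u
  assume "u \<in> flatten_process d X ` {..<d * n}"
  then obtain a where a: "a < d * n" "u = flatten_process d X a"
    by auto
  have "a div d < n"
    using a(1) by (simp add: less_mult_imp_div_less mult.commute)
  moreover have "a mod d < d"
    using a(1) by (cases "d = 0") auto
  ultimately show "u \<in> {(\<lambda>\<omega>. X k \<omega> $ j) | k j. k \<in> {1..int n} \<and> j < d}"
    unfolding a(2) flatten_process_def
    by (intro CollectI exI[of _ "int (a div d) + 1"] exI[of _ "a mod d"]) auto
next
  fix u
  assume "u \<in> {(\<lambda>\<omega>. X k \<omega> $ j) | k j. k \<in> {1..int n} \<and> j < d}"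
  then obtain k j where kj: "k \<in> {1..int n}" "j < d" "u = (\<lambda>\<omega>. X k \<omega> $ j)"
    by auto
  then have s: "nat k \<in> {1..n}" "int (nat k) = k"
    by auto
  then have "u = flatten_process d X ((nat k - 1) * d + j)"
    using kj flatten_process_block[of "nat k" j d X] by simp
  then show "u \<in> flatten_process d X ` {..<d * n}"
    using block_index_less[OF s(1) kj(2)] by blast
qed

lemma gram_index:
  assumes "i < d" "j < d"
  shows "gram d M x y $$ (i, j) = L2_inner M (\<lambda>\<omega>. x \<omega> $ i) (\<lambda>\<omega>. y \<omega> $ j)"
  using assms by (simp add: gram_def)

theorem theorem3p1:
  fixes d n s t :: nat
    and w :: "complex \<Rightarrow> complex mat"
    and M :: "'a measure"
    and X X' :: "int \<Rightarrow> 'a \<Rightarrow> complex vec"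
  assumes "d \<ge> 1"
    and "\<And>z. cmod z = 1 \<Longrightarrow> w z \<in> carrier_mat d d"
    and "L1_mat d w"
    and "AE \<theta> in circle_measure. positive_hermitian d (w (cis \<theta>))"
    and "L1_mat d (\<lambda>z. minv (w z))"
    and "prob_space M"
    and "centered_weakly_stationary d M X"
    and "has_spectral_density d M X w"
    and "dual_process d M X X'"
    and "n \<ge> 1" and "s \<in> {1..n}" and "t \<in> {1..n}"
  shows "mat_inverse (block_toeplitz d n w) \<noteq> None \<and>
    mat_block d (minv (block_toeplitz d n w)) s t =
      gram d M (X' (int s)) (orth_proj_vec d M (process_space d M X {1..int n}) (X' (int t)))"
proof -
  let ?N = "d * n" and ?x = "flatten_process d X" and ?y = "flatten_process d X'"
  let ?S = "process_space d M X {1..int n}"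
  have md: "a mod d < d" for a
    using assms(1) by simp
  have stat': "centered_weakly_stationary d M X'"
    and dual: "gram d M (X k) (X' l) = (if k = l then 1\<^sub>m d else 0\<^sub>m d d)" for k l
    using assms(9) by (auto simp: dual_process_def)
  have x: "?x a \<in> L2_space M" and y: "?y a \<in> L2_space M" for a
    using assms(7) stat' md by (auto simp: centered_weakly_stationary_def flatten_process_def)
  have bi: "L2_inner M (?x a) (?y b) = (if a = b then 1 else 0)" for a b
  proof -
    have "L2_inner M (?x a) (?y b)
        = gram d M (X (int (a div d) + 1)) (X' (int (b div d) + 1)) $$ (a mod d, b mod d)"
      by (simp add: gram_index md flatten_process_def)
    also have "\<dots> = (if a div d = b div d \<and> a mod d = b mod d then 1 else 0)"
      using md by (simp add: dual)
    also have "(a div d = b div d \<and> a mod d = b mod d) \<longleftrightarrow> a = b"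
      by (metis div_mult_mod_eq)
    finally show ?thesis .
  qed
  have toeplitz: "block_toeplitz d n w = gram_matrix M ?N ?x"
  proof (rule eq_matI)
    fix a b
    assume ab: "a < dim_row (gram_matrix M ?N ?x)" "b < dim_col (gram_matrix M ?N ?x)"
    have "gram d M (X (int (a div d) + 1)) (X (int (b div d) + 1))
        = fourier_coeff d w (int (a div d) - int (b div d))"
      using assms(8) by (simp add: has_spectral_density_def)
    then have "fourier_coeff d w (int (a div d) - int (b div d)) $$ (a mod d, b mod d)
        = L2_inner M (?x a) (?x b)"
      by (simp add: gram_index md flatten_process_def flip: gram_index[OF md md])
    then show "block_toeplitz d n w $$ (a, b) = gram_matrix M ?N ?x $$ (a, b)"
      using ab by (simp add: block_toeplitz_def gram_matrix_def)
  qed (simp_all add: block_toeplitz_def gram_matrix_def)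
  have S: "?S = L2_closure M (fun_span (?x ` {..<?N}))"
    unfolding process_space_def flatten_process_image ..
  have inv: "mat_inverse (block_toeplitz d n w) =
      Some (mat ?N ?N (\<lambda>(a, b). L2_inner M (?y a) (orth_proj M ?S (?y b))))"
    unfolding toeplitz S by (rule biorthogonal_gram_inverse[OF x y bi])
  have "mat_block d (minv (block_toeplitz d n w)) s t =
      gram d M (X' (int s)) (orth_proj_vec d M ?S (X' (int t)))" (is "?lhs = ?rhs")
  proof (rule eq_matI)
    fix i j
    assume "i < dim_row ?rhs" "j < dim_col ?rhs"
    then have ij: "i < d" "j < d"
      by (simp_all add: gram_def)
    have st: "1 \<le> s" "1 \<le> t"
      using assms(11,12) by auto
    have "?lhs $$ (i, j) = L2_inner M (?y ((s - 1) * d + i)) (orth_proj M ?S (?y ((t - 1) * d + j)))"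
      using ij block_index_less[OF assms(11) ij(1)] block_index_less[OF assms(12) ij(2)]
      by (simp add: mat_block_def inv)
    also have "\<dots> = ?rhs $$ (i, j)"
      unfolding flatten_process_block[OF st(1) ij(1)] flatten_process_block[OF st(2) ij(2)]
      using ij by (simp add: gram_index orth_proj_vec_def)
    finally show "?lhs $$ (i, j) = ?rhs $$ (i, j)" .
  qed (simp_all add: mat_block_def gram_def)
  with inv show ?thesis
    by simp
qed

end
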